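(* Let $k$ and $q$ be integers with $q\ge2$ and $\gcd(k,q)=1$. Let $c_0,c_1\in\mathbb C$ with $c_0\ne c_1$. Let $B=(z_{2,q},\kappa)$ be the absolute turtle curve whose interpreter function is $\kappa((x,y))=c_x\zeta_q^{ky}$ for $(x,y)\in\mathbb Z/2\mathbb Z\times\mathbb Z/q\mathbb Z$. Then $B\sim D_{2,q,k}$.
   Context: Notation: $\mathbb N=\{0,1,2,\dots\}$; $\zeta_m=e^{2\pi i/m}$. The Thue-Morse sequence $t_2:\mathbb N\to\mathbb Z/2\mathbb Z$ is defined by $t_2(0)=0$ and $t_2(2m+s)=t_2(m)+\overline s$ for $m\in\mathbb N$, $0\le s<2$. For $q\ge2$, $z_{2,q}:\mathbb N\to\mathbb Z/2\mathbb Z\times\mathbb Z/q\mathbb Z$ is $z_{2,q}(n)=(t_2(n),\overline n)$. An absolute turtle curve $T=(\sigma,\tau)$ is given by a sequence $\sigma:\mathbb N\to A$ over a finite alphabet $A$ and a function $\tau:A\to\mathbb C$ (the interpreter function); it is viewed as the sequence of points $T(n)=\sum_{i=0}^{n-1}\tau(\sigma(i))\in\mathbb C$. For an integer $k$ with $\gcd(k,q)=1$, the Dekking curve $D_{2,q,k}$ is the absolute turtle curve $(z_{2,q},\tau)$ with $\tau((x,y))=(-1)^x\zeta_q^{ky}$. Turtle curves $T_1,T_2$ are similar, $T_1\sim T_2$, if there exist positive integers $k_1,k_2$ and $c\in\mathbb C^\times$ such that $c\cdot T_1(k_1n)=T_2(k_2n)$ for all $n\in\mathbb N$. *)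

theory Defs
  imports Complex_Main "HOL-Number_Theory.Residues"
begin

text \<open>
  The ring \<open>\<int>/m\<int>\<close> is \<^const>\<open>residue_ring\<close> \<open>m\<close>, with carrier \<open>{0..m - 1}\<close>;
  the class of \<open>n\<close> is its representative \<open>n mod m\<close>.
\<close>

definition zeta :: "int \<Rightarrow> complex" where
  "zeta m = exp (2 * of_real pi * \<i> / of_int m)"

fun thue_morse :: "nat \<Rightarrow> int" where
  "thue_morse n =
     (if n = 0 then 0 else thue_morse (n div 2) \<oplus>\<^bsub>residue_ring 2\<^esub> (int (n mod 2) mod 2))"

declare thue_morse.simps [simp del]

lemma thue_morse_in_carrier: "thue_morse n \<in> carrier (residue_ring 2)"
  by (subst thue_morse.simps) (auto simp: residue_ring_def)

lemma thue_morse_0: "thue_morse 0 = 0"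
  by (simp add: thue_morse.simps)

lemma thue_morse_rec:
  assumes "s < 2"
  shows "thue_morse (2 * m + s) = thue_morse m \<oplus>\<^bsub>residue_ring 2\<^esub> (int s mod 2)"
proof (cases "2 * m + s = 0")
  case True
  then show ?thesis by (simp add: thue_morse_0 residue_ring_def)
next
  case False
  with assms show ?thesis by (subst thue_morse.simps) auto
qed

definition z2 :: "int \<Rightarrow> nat \<Rightarrow> int \<times> int" where
  "z2 q n = (thue_morse n, int n mod q)"

definition z2_alphabet :: "int \<Rightarrow> (int \<times> int) set" where
  "z2_alphabet q = carrier (residue_ring 2) \<times> carrier (residue_ring q)"

text \<open>
  The interpreter is a total function; only its values on the alphabet matter.
\<close>

datatype 'a turtle_curve =
  Turtle (alphabet: "'a set") (letters: "nat \<Rightarrow> 'a") (interpreter: "'a \<Rightarrow> complex")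

definition absolute_turtle_curve :: "'a turtle_curve \<Rightarrow> bool" where
  "absolute_turtle_curve T \<longleftrightarrow> finite (alphabet T) \<and> range (letters T) \<subseteq> alphabet T"

definition point :: "'a turtle_curve \<Rightarrow> nat \<Rightarrow> complex" where
  "point T n = (\<Sum>i<n. interpreter T (letters T i))"

definition similar :: "'a turtle_curve \<Rightarrow> 'b turtle_curve \<Rightarrow> bool" (infix \<open>\<sim>\<^sub>T\<close> 50) where
  "T1 \<sim>\<^sub>T T2 \<longleftrightarrow>
     absolute_turtle_curve T1 \<and> absolute_turtle_curve T2 \<and>
     (\<exists>k1 k2 :: nat. \<exists>c :: complex. k1 > 0 \<and> k2 > 0 \<and> c \<noteq> 0 \<and>
        (\<forall>n. c * point T1 (k1 * n) = point T2 (k2 * n)))"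

definition dekking_curve :: "int \<Rightarrow> int \<Rightarrow> (int \<times> int) turtle_curve" where
  "dekking_curve q k =
     Turtle (z2_alphabet q) (z2 q) (\<lambda>(x, y). (-1) powi x * zeta q powi (k * y))"

end

theory Submission
  imports Defs "HOL-Analysis.Complex_Transcendental"
begin

text \<open>
  Write \<open>c\<^sub>x = a + b (-1)\<^sup>x\<close> with \<open>a = (c\<^sub>0 + c\<^sub>1) / 2\<close> and
  \<open>b = (c\<^sub>0 - c\<^sub>1) / 2 \<noteq> 0\<close>. The points of the curve are then \<open>b\<close> times those of the
  Dekking curve plus \<open>a\<close> times partial sums of the geometric series of \<open>\<zeta>\<^sub>q\<^sup>k\<close>. Since
  \<open>\<zeta>\<^sub>q\<^sup>k \<noteq> 1\<close> is a \<open>q\<close>-th root of unity, these partial sums vanish at all multiples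
  of \<open>q\<close>.
\<close>

lemma zeta_powi: "zeta m powi k = exp (2 * of_real pi * \<i> * of_int k / of_int m)"
proof -
  have "zeta m powi k = exp (of_int k * (2 * of_real pi * \<i> / of_int m))"
    unfolding zeta_def by (simp add: exp_power_int)
  then show ?thesis
    by (simp add: mult_ac)
qed

text \<open>The kernel of \<open>exp\<close> is generated by 2 pi i, so the exponent
  \<open>2 * pi * k / m\<close> must be an integer multiple of 2 pi.\<close>

lemma zeta_powi_eq_1_iff:
  assumes "m \<noteq> 0"
  shows "zeta m powi k = 1 \<longleftrightarrow> m dvd k"
proof -
  have "zeta m powi k = 1 \<longleftrightarrow> (\<exists>n::int. 2 * pi * k / m = of_int (2 * n) * pi)"
    unfolding zeta_powi exp_eq_1 by simp
  also have "\<dots> \<longleftrightarrow> (\<exists>n::int. real_of_int k = real_of_int (m * n))"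
    using assms by (simp add: field_simps)
  also have "\<dots> \<longleftrightarrow> m dvd k"
    unfolding of_int_eq_iff dvd_def by simp
  finally show ?thesis .
qed

text \<open>Changing the exponent by a multiple of \<open>m\<close> does not affect the power of an
  \<open>m\<close>-th root of unity. This turns sums over residues into geometric sums.\<close>

lemma zeta_powi_mult_mod:
  assumes "m \<noteq> 0"
  shows "zeta m powi (k * (int i mod m)) = (zeta m powi k) ^ i"
proof -
  have nz: "zeta m \<noteq> 0"
    by (simp add: zeta_def)
  have "k * int i = k * (int i mod m) + m * (k * (int i div m))"
    by (metis distrib_left mod_mult_div_eq mult.left_commute)
  then have "zeta m powi (k * int i)
      = zeta m powi (k * (int i mod m)) * zeta m powi (m * (k * (int i div m)))"
    using nz by (simp add: power_int_add)
  also have "zeta m powi (m * (k * (int i div m))) = 1"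
    using assms by (simp add: zeta_powi_eq_1_iff)
  finally show ?thesis
    by (simp add: power_int_mult)
qed

lemma sum_zeta_powi_multiple:
  assumes "q > 0" and "\<not> q dvd k"
  shows "(\<Sum>i<nat q * n. zeta q powi (k * (int i mod q))) = 0"
proof -
  let ?w = "zeta q powi k"
  have w: "?w \<noteq> 1"
    using assms by (simp add: zeta_powi_eq_1_iff)
  \<comment> \<open>The residue of \<open>nat q * n\<close> modulo \<open>q\<close> is 0, which
    makes this power 1 and the numerator of the geometric sum 0.\<close>
  have "?w ^ (nat q * n) = zeta q powi (k * (int (nat q * n) mod q))"
    using assms by (simp only: zeta_powi_mult_mod)
  then have "?w ^ (nat q * n) = 1"
    using assms by simp
  then have "(\<Sum>i<nat q * n. ?w ^ i) = 0"
    using w by (simp add: geometric_sum)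
  then show ?thesis
    using assms by (simp add: zeta_powi_mult_mod)
qed

lemma thue_morse_cases: "thue_morse n = 0 \<or> thue_morse n = 1"
  using thue_morse_in_carrier[of n] by (auto simp: residue_ring_def)

lemma absolute_turtle_curve_z2:
  assumes "q > 0"
  shows "absolute_turtle_curve (Turtle (z2_alphabet q) (z2 q) f)"
  using assms thue_morse_in_carrier
  by (auto simp: absolute_turtle_curve_def z2_alphabet_def z2_def residue_ring_def)

theorem theorem4:
  fixes k q :: int and c0 c1 :: complex
  assumes "q \<ge> 2" and "gcd k q = 1" and "c0 \<noteq> c1"
  shows "Turtle (z2_alphabet q) (z2 q)
           (\<lambda>(x, y). (if x = 0 then c0 else c1) * zeta q powi (k * y))
         \<sim>\<^sub>T dekking_curve q k"
    (is "?B \<sim>\<^sub>T _")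
proof -
  define a where "a = (c0 + c1) / 2"
  define b where "b = (c0 - c1) / 2"
  have b: "b \<noteq> 0"
    using assms by (simp add: b_def)
  \<comment> \<open>This gives \<open>zeta q powi k \<noteq> 1\<close>; otherwise coprimality would
    force \<open>q dvd 1\<close>, against \<open>q \<ge> 2\<close>.\<close>
  have ndvd: "\<not> q dvd k"
  proof
    assume "q dvd k"
    then have "q dvd gcd k q" by simp
    then show False using assms by simp
  qed
  have coeff: "(if thue_morse i = 0 then c0 else c1) = a + b * (-1) powi thue_morse i" for i
    using thue_morse_cases[of i] by (auto simp: a_def b_def field_simps)
  have pt: "point ?B n
      = a * (\<Sum>i<n. zeta q powi (k * (int i mod q))) + b * point (dekking_curve q k) n" for n
    by (simp add: point_def dekking_curve_def z2_def coeff sum_distrib_left sum.distrib algebra_simps)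
  \<comment> \<open>The witnesses for similarity are \<open>k1 = k2 = nat q\<close> and
    \<open>c = 1 / b\<close>: sampling at multiples of \<open>q\<close> removes the \<open>a\<close>
    part.\<close>
  have "1 / b * point ?B (nat q * n) = point (dekking_curve q k) (nat q * n)" for n
    using sum_zeta_powi_multiple[of q k n] assms ndvd b by (simp add: pt)
  moreover have "nat q > 0" "1 / b \<noteq> 0"
    using assms b by auto
  moreover have "absolute_turtle_curve ?B" "absolute_turtle_curve (dekking_curve q k)"
    using assms by (auto simp: dekking_curve_def intro!: absolute_turtle_curve_z2)
  ultimately show ?thesis
    unfolding similar_def by blast
qed

end
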